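(* Let $f:\mathbb{R}^N\to\mathbb{R}$ be differentiable and strongly convex with parameters $(L,l)$ (relative to the starting point $\mathbf{x}^0$), with minimizer $\mathbf{x}^*$. Let $\mathbf{x}^0,\mathbf{x}^1,\mathbf{x}^2,\ldots$ be the iterates obtained by applying nonlinear conjugate gradient (any variant) to $f$ from $\mathbf{x}^0$, write $\mathbf{g}^j=\nabla f(\mathbf{x}^j)$, and suppose $\mathbf{g}^j\neq 0$ for $0\le j\le m-1$. Assume that the step at each iteration satisfies $$f(\mathbf{x}^{j+1})\le f(\mathbf{x}^j)-\frac{1}{2L}\|\mathbf{g}^j\|^2 .$$ Let $\rho\ge 1$ be a constant and put $$\lambda^j=\sqrt{\frac{f(\mathbf{x}^j)-f(\mathbf{x}^{j+1})}{\|\mathbf{g}^j\|^2}} .$$ Suppose that $m$ is an integer with $m\ge \left\lceil 8\rho\sqrt{L/l}\,\right\rceil$ and that $$\frac{f(\mathbf{x}^{m-1})-f(\mathbf{x}^0)}{4}\left(\sum_{j=0}^{m-1}\lambda^j\right)+\sum_{j=0}^{m-1}\lambda^j\left\langle \mathbf{g}^j,\mathbf{x}^j-\mathbf{x}^0\right\rangle<0$$ and $$\left\|\sum_{j=0}^{m-1}\lambda^j\mathbf{g}^j\right\|\le\rho\sqrt{\sum_{j=0}^{m-1}(\lambda^j)^2\|\mathbf{g}^j\|^2}.$$ Then the residual of the function is divided in half after $m$ iterations, i.e. $$v_f(\mathbf{x}^m)\le\frac12 v_f(\mathbf{x}^0).$$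
   Context: $\langle\cdot,\cdot\rangle$ is the Euclidean inner product and $\|\cdot\|$ the 2-norm. Superscripts on vectors and on $\lambda$ are iteration indices, except that $(\lambda^j)^2$ and $\|\cdot\|^2$ denote squares. Strong convexity: $f$ is strongly convex with parameters $(L,l)$, where $L,l>0$, if for all $\mathbf{x},\mathbf{y}$ in the level set $\{\mathbf{z}: f(\mathbf{z})\le f(\mathbf{x}^0)\}$, $$\|\nabla f(\mathbf{x})-\nabla f(\mathbf{y})\|\le L\|\mathbf{x}-\mathbf{y}\|,\qquad f(\mathbf{y})-f(\mathbf{x})\ge\langle\nabla f(\mathbf{x}),\mathbf{y}-\mathbf{x}\rangle+\frac{l}{2}\|\mathbf{y}-\mathbf{x}\|^2 .$$ Residual: $v_f(\mathbf{x})=f(\mathbf{x})-f(\mathbf{x}^* )$, where $\mathbf{x}^*$ is the minimizer of $f$. Nonlinear conjugate gradient: iterations of the form $\mathbf{x}^{j+1}=\mathbf{x}^j+\alpha^j\mathbf{d}^j$, $\mathbf{d}^{j+1}=-\mathbf{g}^{j+1}+\beta^j\mathbf{d}^j$, with $\mathbf{d}^0=-\mathbf{g}^0$, where $\alpha^j$ is a real step size and $\beta^j$ is a real number; different rules for choosing $\beta^j$ give the different variants. "Any variant" means that the choice of $\alpha^j,\beta^j$ is not restricted beyond the stated decrease condition. *)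

theory Defs
  imports "HOL-Analysis.Analysis"
begin

definition gradient :: "('a::real_inner \<Rightarrow> real) \<Rightarrow> 'a \<Rightarrow> 'a"
  where "gradient f x = (THE g. GDERIV f x :> g)"

lemma gradient_eqI:
  fixes f :: "'a::real_inner \<Rightarrow> real"
  assumes "GDERIV f x :> g"
  shows "gradient f x = g"
proof -
  have "h = g" if "GDERIV f x :> h" for h
  proof -
    have "(\<lambda>y. inner y h) = (\<lambda>y. inner y g)"
      using that assms unfolding gderiv_def by (rule has_derivative_unique)
    then have "inner (h - g) h = inner (h - g) g"
      by (rule fun_cong)
    then have "inner (h - g) (h - g) = 0"
      by (simp add: inner_diff_right)
    then show "h = g" by simp
  qed
  then show ?thesis
    unfolding gradient_def using assms by blast
qed

lemma gderiv_gradient: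
  fixes f :: "'a::euclidean_space \<Rightarrow> real"
  assumes "f differentiable (at x)"
  shows "GDERIV f x :> gradient f x"
proof -
  obtain f' where f': "(f has_derivative f') (at x)"
    using assms unfolding differentiable_def by blast
  then interpret linear f' by (rule has_derivative_linear)
  define g where "g = (\<Sum>b\<in>Basis. f' b *\<^sub>R b)"
  have "f' h = inner h g" for h
  proof -
    have "f' h = f' (\<Sum>b\<in>Basis. (h \<bullet> b) *\<^sub>R b)"
      by (simp add: euclidean_representation)
    also have "\<dots> = (\<Sum>b\<in>Basis. (h \<bullet> b) * f' b)"
      by (simp add: sum scale)
    also have "\<dots> = inner h g"
      by (simp add: g_def inner_sum_right mult.commute)
    finally show ?thesis .
  qed
  then have "f' = (\<lambda>h. inner h g)" by blast
  then have "GDERIV f x :> g"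
    using f' by (simp add: gderiv_def)
  then show ?thesis
    using gradient_eqI by metis
qed

definition strongly_convex_from ::
    "('a::real_inner \<Rightarrow> real) \<Rightarrow> 'a \<Rightarrow> real \<Rightarrow> real \<Rightarrow> bool"
  where "strongly_convex_from f x0 L l \<longleftrightarrow>
    0 < L \<and> 0 < l \<and>
    (\<forall>x \<in> {z. f z \<le> f x0}. \<forall>y \<in> {z. f z \<le> f x0}.
      norm (gradient f x - gradient f y) \<le> L * norm (x - y) \<and>
      f y - f x \<ge> gradient f x \<bullet> (y - x) + l / 2 * (norm (y - x))\<^sup>2)"

definition residual :: "('a \<Rightarrow> real) \<Rightarrow> 'a \<Rightarrow> 'a \<Rightarrow> real"
  where "residual f xstar x = f x - f xstar"

text \<open>The step sizes \<open>\<alpha>\<close> and the coefficients \<open>\<beta>\<close> are arbitrary reals, so that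
  every variant of the method is covered. A run that reaches a stationary point can
  be continued by zero steps.\<close>

definition nonlinear_cg ::
    "('a::real_inner \<Rightarrow> real) \<Rightarrow> (nat \<Rightarrow> 'a) \<Rightarrow> (nat \<Rightarrow> 'a) \<Rightarrow>
      (nat \<Rightarrow> real) \<Rightarrow> (nat \<Rightarrow> real) \<Rightarrow> bool"
  where "nonlinear_cg f x d \<alpha> \<beta> \<longleftrightarrow>
    d 0 = - gradient f (x 0) \<and>
    (\<forall>j. x (Suc j) = x j + \<alpha> j *\<^sub>R d j \<and>
         d (Suc j) = - gradient f (x (Suc j)) + \<beta> j *\<^sub>R d j)"

end

theory Submission
  imports Defs
begin

text \<open>
  Argue by contradiction: suppose that the residuals \<open>v\<^sub>j = f (x\<^sub>j) - f (x\<^sup>*)\<close> satisfy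
  \<open>v\<^sub>m > v\<^sub>0 / 2\<close>. Convexity gives \<open>v\<^sub>j \<le> \<langle>g\<^sub>j, x\<^sub>j - x\<^sup>*\<rangle>\<close> for every iterate
  (\<open>residual_le_inner_gradient\<close>). Weighting with \<open>\<lambda>\<^sub>j\<close>, summing, and splitting
  \<open>x\<^sub>j - x\<^sup>*\<close> at the starting point \<open>x\<^sub>0\<close> yields

  \<open>\<Sum> \<lambda>\<^sub>j v\<^sub>j \<le> \<Sum> \<lambda>\<^sub>j \<langle>g\<^sub>j, x\<^sub>j - x\<^sub>0\<rangle> + \<langle>\<Sum> \<lambda>\<^sub>j g\<^sub>j, x\<^sub>0 - x\<^sup>*\<rangle>\<close>.

  The first term on the right is below \<open>(v\<^sub>0 - v\<^bsub>m-1\<^esub>) / 4\<close> times \<open>\<Lambda> = \<Sum> \<lambda>\<^sub>j\<close> by hypothesis.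
  The second is handled by Cauchy--Schwarz. The weights are chosen so that
  \<open>\<lambda>\<^sub>j\<^sup>2 \<parallel>g\<^sub>j\<parallel>\<^sup>2\<close> is exactly the decrease in step \<open>j\<close>, so the assumed near-orthogonality bounds
  \<open>\<parallel>\<Sum> \<lambda>\<^sub>j g\<^sub>j\<parallel>\<close> by \<open>\<rho> \<surd>(v\<^sub>0 - v\<^sub>m) \<le> \<rho> \<surd>(v\<^sub>0 / 2)\<close>, while strong convexity at the stationary
  point \<open>x\<^sup>*\<close> bounds \<open>\<parallel>x\<^sub>0 - x\<^sup>*\<parallel>\<close> by \<open>\<surd>(2 v\<^sub>0 / l)\<close>
  (\<open>dist_to_stationary_point_le\<close>); the product is \<open>\<rho> v\<^sub>0 / \<surd>l\<close>.
  On the left, every \<open>v\<^sub>j\<close> is at least \<open>v\<^bsub>m-1\<^esub> > v\<^sub>0 / 2\<close>. Altogether \<open>3/8 \<Lambda> v\<^sub>0 < \<rho> v\<^sub>0 / \<surd>l\<close>.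
  The sufficient decrease condition, however, says \<open>\<lambda>\<^sub>j \<ge> 1 / \<surd>(2L)\<close>
  (\<open>step_weight_ge\<close>), so
  \<open>\<Lambda> \<ge> m / \<surd>(2L) \<ge> 8\<rho> / \<surd>(2l)\<close>, which is too large because \<open>3/8 \<cdot> 8/\<surd>2 = 3/\<surd>2 > 1\<close>
  (\<open>sum_weights_large\<close>).
\<close>

lemma gradient_at_minimizer_eq_0:
  fixes f :: "'a::euclidean_space \<Rightarrow> real"
  assumes "f differentiable (at z)" and "\<And>y. f z \<le> f y"
  shows "gradient f z = 0"
proof -
  have "(f has_derivative (\<lambda>h. inner h (gradient f z))) (at z)"
    using gderiv_gradient[OF assms(1)] by (simp add: gderiv_def)
  then have "(\<lambda>h. inner h (gradient f z)) = (\<lambda>h. 0)"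
    using differential_zero_maxmin[of z UNIV f] assms(2) by auto
  then have "inner (gradient f z) (gradient f z) = 0"
    by (rule fun_cong)
  then show ?thesis by simp
qed

lemma residual_le_inner_gradient:
  assumes "strongly_convex_from f x0 L l" and "f y \<le> f x0" and "f z \<le> f x0"
  shows "residual f z y \<le> gradient f y \<bullet> (y - z)"
proof -
  have "f z - f y \<ge> gradient f y \<bullet> (z - y) + l / 2 * (norm (z - y))\<^sup>2" and "0 < l"
    using assms by (auto simp: strongly_convex_from_def)
  moreover have "0 \<le> l / 2 * (norm (z - y))\<^sup>2"
    using \<open>0 < l\<close> by simp
  ultimately show ?thesis
    unfolding residual_def inner_diff_right by linarith
qed

lemma dist_to_stationary_point_le:
  assumes "strongly_convex_from f x0 L l" and "gradient f z = 0"
    and "f y \<le> f x0" and "f z \<le> f x0"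
  shows "norm (y - z) \<le> sqrt (2 * residual f z y / l)"
proof -
  have "f y - f z \<ge> gradient f z \<bullet> (y - z) + l / 2 * (norm (y - z))\<^sup>2" and "0 < l"
    using assms(1,3,4) by (auto simp: strongly_convex_from_def)
  then have "(norm (y - z))\<^sup>2 \<le> 2 * residual f z y / l"
    using assms(2) by (simp add: residual_def field_simps)
  then show ?thesis by (rule real_le_rsqrt)
qed

text \<open>
  With \<open>v = g\<^sub>j\<close> and \<open>\<delta>\<close> the decrease of \<open>f\<close> in step \<open>j\<close>, the square root is \<open>\<lambda>\<^sub>j\<close>. Sufficient
  decrease serves twice: it makes the radicand nonnegative, so that squaring undoes the root,
  and it keeps the weight away from zero uniformly in \<open>j\<close>.
\<close>

lemma step_weight:
  fixes v :: "'a::real_normed_vector" and \<delta> L :: real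
  assumes "v \<noteq> 0" and "0 < L" and "1 / (2 * L) * (norm v)\<^sup>2 \<le> \<delta>"
  shows step_weight_squared: "(sqrt (\<delta> / (norm v)\<^sup>2))\<^sup>2 * (norm v)\<^sup>2 = \<delta>"
    and step_weight_ge: "1 / sqrt (2 * L) \<le> sqrt (\<delta> / (norm v)\<^sup>2)"
proof -
  have "0 < (norm v)\<^sup>2" using assms(1) by simp
  then have ge: "1 / (2 * L) \<le> \<delta> / (norm v)\<^sup>2"
    using assms(3) by (simp add: pos_le_divide_eq)
  then have "0 \<le> \<delta> / (norm v)\<^sup>2"
    using assms(2) by (meson order_trans divide_nonneg_pos mult_pos_pos zero_le_one zero_less_numeral)
  then show "(sqrt (\<delta> / (norm v)\<^sup>2))\<^sup>2 * (norm v)\<^sup>2 = \<delta>"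
    using assms(1) by simp
  show "1 / sqrt (2 * L) \<le> sqrt (\<delta> / (norm v)\<^sup>2)"
    using real_sqrt_le_mono[OF ge] by (simp add: real_sqrt_divide)
qed

text \<open>
  The lower bound on \<open>m\<close> is exploited here: it makes the total weight \<open>\<Lambda>\<close> exceed
  \<open>8/3 \<cdot> \<rho> / \<surd>l\<close>, the bound that slow progress would force upon it.
\<close>

lemma sum_weights_large:
  fixes lam :: "nat \<Rightarrow> real"
  assumes "0 < L" and "0 < l" and "0 < \<rho>"
    and "\<And>j. j < m \<Longrightarrow> 1 / sqrt (2 * L) \<le> lam j"
    and "8 * \<rho> * sqrt (L / l) \<le> real m"
  shows "8 * \<rho> / sqrt l < 3 * (\<Sum>j<m. lam j)"
proof -
  have "8 * \<rho> / sqrt l = 8 * \<rho> * sqrt (L / l) / sqrt L"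
    using assms(1) by (simp add: real_sqrt_divide)
  also have "\<dots> \<le> real m / sqrt L"
    using assms(1,5) by (simp add: divide_right_mono)
  also have "\<dots> = sqrt 2 * (\<Sum>j<m. 1 / sqrt (2 * L))"
    by (simp add: real_sqrt_mult)
  also have "\<dots> \<le> sqrt 2 * (\<Sum>j<m. lam j)"
    by (intro mult_left_mono sum_mono) (auto intro: assms(4))
  finally have le: "8 * \<rho> / sqrt l \<le> sqrt 2 * (\<Sum>j<m. lam j)" .
  have "0 < 8 * \<rho> / sqrt l"
    using assms(2,3) by simp
  with le have "0 < sqrt 2 * (\<Sum>j<m. lam j)"
    by (rule less_le_trans[rotated])
  then have "0 < (\<Sum>j<m. lam j)"
    by (simp add: zero_less_mult_iff)
  moreover have "sqrt 2 < (3 :: real)"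
    by (rule real_less_lsqrt) auto
  ultimately have "sqrt 2 * (\<Sum>j<m. lam j) < 3 * (\<Sum>j<m. lam j)"
    by (intro mult_strict_right_mono)
  with le show ?thesis by (rule le_less_trans)
qed

theorem lemma1:
  fixes f :: "real ^ 'n \<Rightarrow> real"
    and xstar :: "real ^ 'n"
    and x d g :: "nat \<Rightarrow> real ^ 'n"
    and \<alpha> \<beta> lam :: "nat \<Rightarrow> real"
    and L l \<rho> :: real
    and m :: nat
  assumes "\<forall>z. f differentiable (at z)"
    and "strongly_convex_from f (x 0) L l"
    and "is_arg_min f (\<lambda>_. True) xstar"
    and "nonlinear_cg f x d \<alpha> \<beta>"
    and "\<forall>j. g j = gradient f (x j)"
    and "\<forall>j<m. g j \<noteq> 0"
    and "\<forall>j. f (x (Suc j)) \<le> f (x j) - 1 / (2 * L) * (norm (g j))\<^sup>2"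
    and "\<rho> \<ge> 1"
    and "\<forall>j. lam j = sqrt ((f (x j) - f (x (Suc j))) / (norm (g j))\<^sup>2)"
    and "int m \<ge> \<lceil>8 * \<rho> * sqrt (L / l)\<rceil>"
    and "(f (x (m - 1)) - f (x 0)) / 4 * (\<Sum>j<m. lam j)
           + (\<Sum>j<m. lam j * (g j \<bullet> (x j - x 0))) < 0"
    and "norm (\<Sum>j<m. lam j *\<^sub>R g j)
           \<le> \<rho> * sqrt (\<Sum>j<m. (lam j)\<^sup>2 * (norm (g j))\<^sup>2)"
  shows "residual f xstar (x m) \<le> 1 / 2 * residual f xstar (x 0)"
proof (rule ccontr)
  assume slow: "\<not> ?thesis"
  note convex = assms(2) and decrease = assms(7) and small_inner = assms(11)
    and near_orthogonal = assms(12)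
  define v where "v j = residual f xstar (x j)" for j
  define \<Lambda> where "\<Lambda> = (\<Sum>j<m. lam j)"

  have pos: "0 < L" "0 < l"
    using convex by (auto simp: strongly_convex_from_def)
  have min: "f xstar \<le> f y" for y
    using assms(3) by (auto simp: is_arg_min_linorder)
  have "f (x (Suc j)) \<le> f (x j)" for j
  proof -
    have "0 \<le> 1 / (2 * L) * (norm (g j))\<^sup>2" using pos by simp
    then show ?thesis using decrease[rule_format, of j] by linarith
  qed
  then have mono: "f (x j) \<le> f (x i)" if "i \<le> j" for i j
    using that lift_Suc_antimono_le[of "\<lambda>j. f (x j)"] by blast
  have v_mono: "v j \<le> v i" if "i \<le> j" for i j
    using mono[OF that] by (simp add: v_def residual_def)
  have half: "v 0 / 2 < v m"
    using slow by (simp add: v_def)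
  have v0: "0 < v 0"
    using half v_mono[of 0 m] by simp

  have lam_sq: "(lam j)\<^sup>2 * (norm (g j))\<^sup>2 = f (x j) - f (x (Suc j))"
    and lam_ge: "1 / sqrt (2 * L) \<le> lam j" if "j < m" for j
  proof -
    have "1 / (2 * L) * (norm (g j))\<^sup>2 \<le> f (x j) - f (x (Suc j))"
      using decrease[rule_format, of j] by linarith
    moreover have "g j \<noteq> 0"
      using assms(6) that by blast
    ultimately show "(lam j)\<^sup>2 * (norm (g j))\<^sup>2 = f (x j) - f (x (Suc j))"
      and "1 / sqrt (2 * L) \<le> lam j"
      using pos(1) step_weight[of "g j" L "f (x j) - f (x (Suc j))"] assms(9) by simp_all
  qed
  have lam_nonneg: "0 \<le> lam j" if "j < m" for j
    by (rule order_trans[OF _ lam_ge[OF that]]) (simp add: pos less_imp_le)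
  have "8 * \<rho> * sqrt (L / l) \<le> real m"
    using assms(10) by (simp add: ceiling_le_iff)
  then have \<Lambda>_large: "8 * \<rho> / sqrt l < 3 * \<Lambda>"
    unfolding \<Lambda>_def using assms(8) by (intro sum_weights_large[OF pos] lam_ge) auto

  have dist: "norm (x 0 - xstar) \<le> sqrt (2 * v 0 / l)"
    unfolding v_def
    using assms(1) min by (intro dist_to_stationary_point_le[OF convex] gradient_at_minimizer_eq_0) auto
  have "(\<Sum>j<m. (lam j)\<^sup>2 * (norm (g j))\<^sup>2) = f (x 0) - f (x m)"
    using sum_lessThan_telescope'[of "\<lambda>j. f (x j)" m] by (simp add: lam_sq)
  also have "\<dots> \<le> v 0 / 2"
    using half by (simp add: v_def residual_def field_simps)
  finally have "\<rho> * sqrt (\<Sum>j<m. (lam j)\<^sup>2 * (norm (g j))\<^sup>2) \<le> \<rho> * sqrt (v 0 / 2)"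
    using assms(8) by simp
  with near_orthogonal
  have norm_sum: "norm (\<Sum>j<m. lam j *\<^sub>R g j) \<le> \<rho> * sqrt (v 0 / 2)"
    by (rule order_trans)
  have "(\<Sum>j<m. lam j *\<^sub>R g j) \<bullet> (x 0 - xstar)
      \<le> norm (\<Sum>j<m. lam j *\<^sub>R g j) * norm (x 0 - xstar)"
    by (rule norm_cauchy_schwarz)
  also have "\<dots> \<le> (\<rho> * sqrt (v 0 / 2)) * sqrt (2 * v 0 / l)"
    using assms(8) v0 by (intro mult_mono norm_sum dist) auto
  also have "\<dots> = \<rho> * sqrt ((v 0)\<^sup>2 / l)"
    by (simp add: real_sqrt_mult[symmetric] power2_eq_square)
  also have "\<dots> = \<rho> / sqrt l * v 0"
    using v0 by (simp add: real_sqrt_divide)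
  finally have start_term: "(\<Sum>j<m. lam j *\<^sub>R g j) \<bullet> (x 0 - xstar) \<le> \<rho> / sqrt l * v 0" .

  have "(f (x (m - 1)) - f (x 0)) / 4 * \<Lambda> = - (\<Lambda> * ((v 0 - v (m - 1)) / 4))"
    by (simp add: v_def residual_def field_simps)
  then have inner_term: "(\<Sum>j<m. lam j * (g j \<bullet> (x j - x 0))) < \<Lambda> * ((v 0 - v (m - 1)) / 4)"
    using small_inner unfolding \<Lambda>_def by linarith

  have "\<Lambda> * v (m - 1) \<le> (\<Sum>j<m. lam j * v j)"
    unfolding \<Lambda>_def sum_distrib_right
    by (intro sum_mono mult_left_mono v_mono lam_nonneg) auto
  also have "\<dots> \<le> (\<Sum>j<m. lam j * (g j \<bullet> (x j - xstar)))"
    unfolding v_def using assms(5) mono min lam_nonneg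
    by (auto intro!: sum_mono mult_left_mono residual_le_inner_gradient[OF convex])
  also have "\<dots> = (\<Sum>j<m. lam j * (g j \<bullet> (x j - x 0)))
      + (\<Sum>j<m. lam j *\<^sub>R g j) \<bullet> (x 0 - xstar)"
    by (simp add: inner_sum_left inner_diff_right sum.distrib[symmetric] algebra_simps)
  also have "\<dots> < \<Lambda> * ((v 0 - v (m - 1)) / 4) + \<rho> / sqrt l * v 0"
    using inner_term start_term by linarith
  finally have "\<Lambda> * v (m - 1) < \<Lambda> * ((v 0 - v (m - 1)) / 4) + \<rho> / sqrt l * v 0" .
  moreover have "\<Lambda> * (5 * v (m - 1) - v 0)
      = 4 * (\<Lambda> * v (m - 1)) - 4 * (\<Lambda> * ((v 0 - v (m - 1)) / 4))"
    by (simp add: field_simps)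
  ultimately have upper: "\<Lambda> * (5 * v (m - 1) - v 0) < 4 * (\<rho> / sqrt l * v 0)"
    by linarith

  have "0 \<le> \<Lambda>"
    unfolding \<Lambda>_def by (rule sum_nonneg) (simp add: lam_nonneg)
  moreover have "3 / 2 * v 0 \<le> 5 * v (m - 1) - v 0"
    using half v_mono[of "m - 1" m] by simp
  ultimately have "\<Lambda> * (3 / 2 * v 0) \<le> \<Lambda> * (5 * v (m - 1) - v 0)"
    by (intro mult_left_mono)
  with upper have "3 * \<Lambda> * v 0 < 8 * \<rho> / sqrt l * v 0"
    by simp
  with v0 have "3 * \<Lambda> < 8 * \<rho> / sqrt l"
    by (simp only: mult_less_cancel_right_pos)
  with \<Lambda>_large show False by simp
qed

end
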